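(* Let $k$ be a field, let $<$ and $<'$ be monomial preorders on $k[X]=k[x_1,\dots,x_n]$, and let $<^*$ be the product of $<$ with $<'$. Then: (a) $L_{<^*}(G)\subseteq L_{<'}\bigl(L_<(G)\bigr)$ for every subset $G\subseteq k[X]_<$; (b) $L_{<^*}(I)=L_{<'}\bigl(L_<(I)\bigr)$ for every ideal $I\subseteq k[X]_<$; (c) if $<'$ is global, then $k[X]_{<^*}=k[X]_<$.
   Context: For $a\in\mathbb{N}^n$ write $x^a=x_1^{\alpha_1}\cdots x_n^{\alpha_n}$. A weak order on a set is a strict partial order for which incomparability is an equivalence relation. A monomial preorder on $k[X]$ is a weak order $<$ on the monomials such that for all $a,b,c\in\mathbb{N}^n$: $x^a<x^b$ if and only if $x^ax^c<x^bx^c$. It is called global if for each $i$ either $1<x_i$ or $1$ and $x_i$ are incomparable. The product $<^*$ of $<$ with $<'$ is the monomial preorder with $x^a<^*x^b$ iff $x^a<x^b$, or $x^a,x^b$ are incomparable with respect to $<$ and $x^a<'x^b$. For $f=\sum c_ax^a\in k[X]$, the leading part $L_<(f)$ is the sum of those terms $c_ax^a$ ($c_a\ne0$) such that no monomial $x^b$ occurring in $f$ satisfies $x^a<x^b$. Put $S_<=\{u\in k[X]\mid L_<(u)=1\}$ (a multiplicative set) and $k[X]_<=S_<^{-1}k[X]$. For $f\in k[X]_<$ choose $u\in S_<$ with $uf\in k[X]$ and set $L_<(f)=L_<(uf)$ (independent of $u$). For a subset $G\subseteq k[X]_<$, $L_<(G)$ is the ideal of $k[X]$ generated by all $L_<(f)$,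 $f\in G$. Since $S_<\subseteq S_{<^*}$, one has $k[X]_<\subseteq k[X]_{<^*}$, so subsets of $k[X]_<$ are also subsets of $k[X]_{<^*}$. *)

theory Defs
  imports
    "HOL-Library.Poly_Mapping"
    "HOL-Computational_Algebra.Polynomial_Factorial"
    "HOL-Algebra.Algebraic_Closure_Type"
begin

text \<open>
  The variables are indexed by a finite linearly ordered type \<open>'n\<close>. A monomial is represented by its
  exponent vector, so the monomial \<open>1\<close> is \<open>0\<close>, a variable is \<open>Poly_Mapping.single i 1\<close>, and the
  product of monomials is addition. The order on \<open>'n\<close> plays no role beyond giving the library's
  integral domain instance for polynomials, and hence their field of fractions.
\<close>

type_synonym 'n monom = "'n \<Rightarrow>\<^sub>0 nat"
type_synonym ('n, 'k) mpoly = "'n monom \<Rightarrow>\<^sub>0 'k"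

definition incomparable :: "('a \<Rightarrow> 'a \<Rightarrow> bool) \<Rightarrow> 'a \<Rightarrow> 'a \<Rightarrow> bool" where
  "incomparable lt a b \<longleftrightarrow> \<not> lt a b \<and> \<not> lt b a"

definition weak_order :: "('a \<Rightarrow> 'a \<Rightarrow> bool) \<Rightarrow> bool" where
  "weak_order lt \<longleftrightarrow> irreflp lt \<and> transp lt \<and> equivp (incomparable lt)"

definition monomial_preorder :: "('n monom \<Rightarrow> 'n monom \<Rightarrow> bool) \<Rightarrow> bool" where
  "monomial_preorder lt \<longleftrightarrow> weak_order lt \<and> (\<forall>a b c. lt a b \<longleftrightarrow> lt (a + c) (b + c))"

definition global_preorder :: "('n monom \<Rightarrow> 'n monom \<Rightarrow> bool) \<Rightarrow> bool" where
  "global_preorder lt \<longleftrightarrow>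
     (\<forall>i. lt 0 (Poly_Mapping.single i 1) \<or> incomparable lt 0 (Poly_Mapping.single i 1))"

definition product_preorder ::
    "('a \<Rightarrow> 'a \<Rightarrow> bool) \<Rightarrow> ('a \<Rightarrow> 'a \<Rightarrow> bool) \<Rightarrow> 'a \<Rightarrow> 'a \<Rightarrow> bool" where
  "product_preorder lt lt' a b \<longleftrightarrow> lt a b \<or> incomparable lt a b \<and> lt' a b"

definition leading_part ::
    "('n monom \<Rightarrow> 'n monom \<Rightarrow> bool) \<Rightarrow> ('n, 'k::comm_monoid_add) mpoly \<Rightarrow> ('n, 'k) mpoly" where
  "leading_part lt f =
     (\<Sum>a \<in> {a \<in> Poly_Mapping.keys f. \<forall>b \<in> Poly_Mapping.keys f. \<not> lt a b}.
        Poly_Mapping.single a (Poly_Mapping.lookup f a))"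

definition denominators ::
    "('n monom \<Rightarrow> 'n monom \<Rightarrow> bool) \<Rightarrow> ('n, 'k::comm_semiring_1) mpoly set" where
  "denominators lt = {u. leading_part lt u = 1}"

text \<open>
  Since \<open>k[X]\<close> is a domain and \<open>0 \<notin> denominators lt\<close>, the localization is taken inside the field of
  fractions; the inclusion of one localization in another is then an inclusion of sets.
\<close>

definition localization ::
    "('n::linorder monom \<Rightarrow> 'n monom \<Rightarrow> bool) \<Rightarrow> ('n, 'k::field) mpoly fract set" where
  "localization lt = {to_fract p / to_fract u | p u. u \<in> denominators lt}"

definition localization_ring ::
    "('n::linorder monom \<Rightarrow> 'n monom \<Rightarrow> bool) \<Rightarrow> ('n, 'k::field) mpoly fract ring" where
  "localization_ring lt = ring_of_type_algebra\<lparr>carrier := localization lt\<rparr>"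

text \<open>\<open>p\<close> below is the polynomial \<open>u f\<close> for the chosen \<open>u\<close>; only elements of \<open>localization lt\<close> matter.\<close>

definition leading_part_loc ::
    "('n::linorder monom \<Rightarrow> 'n monom \<Rightarrow> bool) \<Rightarrow> ('n, 'k::field) mpoly fract \<Rightarrow> ('n, 'k) mpoly" where
  "leading_part_loc lt f =
     leading_part lt (SOME p. \<exists>u \<in> denominators lt. to_fract u * f = to_fract p)"

definition leading_ideal ::
    "('n::linorder monom \<Rightarrow> 'n monom \<Rightarrow> bool) \<Rightarrow> ('n, 'k::field) mpoly fract set
      \<Rightarrow> ('n, 'k) mpoly set" where
  "leading_ideal lt G = genideal ring_of_type_algebra (leading_part_loc lt ` G)"

end

theory Submission
  imports Defs
begin

text \<open>
  Everything follows from \<open>L\<^sub>*(f) = L'(L(f))\<close>, where \<open>L\<close>, \<open>L'\<close>, \<open>L\<^sub>*\<close> are the leading parts for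
  \<open><\<close>, \<open><'\<close> and their product. For the inclusion from right to left in (b), call a polynomial
  homogeneous if its monomials are pairwise incomparable for \<open><\<close>. For an ideal \<open>I\<close>, every homogeneous
  component of an element of \<open>L(I)\<close> is itself of the form \<open>L(p)\<close> with \<open>p \<in> I\<close>. If \<open>g \<in> L(I)\<close>, a nonzero
  homogeneous component of \<open>L'(g)\<close> is the \<open><'\<close>-leading part of the corresponding component \<open>L(p)\<close> of
  \<open>g\<close>, hence equals \<open>L'(L(p)) = L\<^sub>*(p)\<close>. For (c), a global \<open><'\<close> has no monomial below \<open>1\<close>, so
  \<open>L'(g) = 1\<close> forces \<open>g = 1\<close>.
\<close>

section \<open>Restriction of polynomials to sets of monomials, and leading parts\<close>

lift_definition restrict_keys :: "'a set \<Rightarrow> ('a \<Rightarrow>\<^sub>0 'b::zero) \<Rightarrow> ('a \<Rightarrow>\<^sub>0 'b)"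
  is "\<lambda>A f a. f a when a \<in> A"
  by (rule finite_subset[rotated]) auto

lemma lookup_restrict_keys:
  "Poly_Mapping.lookup (restrict_keys A f) a = (Poly_Mapping.lookup f a when a \<in> A)"
  by transfer simp

lemma keys_restrict_keys: "Poly_Mapping.keys (restrict_keys A f) = Poly_Mapping.keys f \<inter> A"
  by (auto simp: in_keys_iff lookup_restrict_keys)

lemma restrict_keys_add:
  fixes f g :: "'a \<Rightarrow>\<^sub>0 'b::monoid_add"
  shows "restrict_keys A (f + g) = restrict_keys A f + restrict_keys A g"
  by (rule poly_mapping_eqI) (simp add: lookup_restrict_keys lookup_add when_add_distrib)

lemma restrict_keys_0 [simp]: "restrict_keys A 0 = 0"
  by (rule poly_mapping_eqI) (simp add: lookup_restrict_keys)

lemma restrict_keys_eq_self: "Poly_Mapping.keys f \<subseteq> A \<Longrightarrow> restrict_keys A f = f"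
  by (rule poly_mapping_eqI) (auto simp: lookup_restrict_keys when_def in_keys_iff)

lemma restrict_keys_eq_0: "Poly_Mapping.keys f \<inter> A = {} \<Longrightarrow> restrict_keys A f = 0"
  by (metis keys_restrict_keys keys_eq_empty)

text \<open>Updating at a key outside the support amounts to adding a single term, so a property
  stable under sums need only be checked on terms.\<close>

lemma poly_mapping_add_induct [case_names zero single add]:
  fixes f :: "'a \<Rightarrow>\<^sub>0 'b::comm_monoid_add"
  assumes "P 0" and "\<And>a c. P (Poly_Mapping.single a c)"
    and "\<And>f g. P f \<Longrightarrow> P g \<Longrightarrow> P (f + g)"
  shows "P f"
proof (induction f rule: update_induct)
  case const
  show ?case by (rule assms(1))
next
  case (update f a b)
  have "Poly_Mapping.update a b f = Poly_Mapping.single a b + f"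
    using update by (intro poly_mapping_eqI)
      (auto simp: lookup_update lookup_add lookup_single when_def in_keys_iff)
  then show ?case
    using assms(2,3) update by metis
qed

text \<open>As a restriction, the leading part has coefficients and support that can be read off
  directly, without the defining sum.\<close>

lemma leading_part_eq_restrict_keys:
  "leading_part lt f = restrict_keys {a. \<forall>b \<in> Poly_Mapping.keys f. \<not> lt a b} f"
proof (rule poly_mapping_eqI)
  fix x
  let ?S = "{a \<in> Poly_Mapping.keys f. \<forall>b \<in> Poly_Mapping.keys f. \<not> lt a b}"
  have "Poly_Mapping.lookup (leading_part lt f) x
      = (\<Sum>a\<in>?S. if x = a then Poly_Mapping.lookup f a else 0)"
    unfolding leading_part_def lookup_sum
    by (rule sum.cong) (auto simp: lookup_single when_def)
  also have "\<dots> = (if x \<in> ?S then Poly_Mapping.lookup f x else 0)"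
    by (subst sum.delta') auto
  finally show "Poly_Mapping.lookup (leading_part lt f) x = Poly_Mapping.lookup
      (restrict_keys {a. \<forall>b \<in> Poly_Mapping.keys f. \<not> lt a b} f) x"
    by (auto simp: lookup_restrict_keys when_def in_keys_iff)
qed

lemma keys_leading_part:
  "Poly_Mapping.keys (leading_part lt f)
     = {a \<in> Poly_Mapping.keys f. \<forall>b \<in> Poly_Mapping.keys f. \<not> lt a b}"
  by (auto simp: leading_part_eq_restrict_keys keys_restrict_keys)

lemma lookup_leading_part:
  "Poly_Mapping.lookup (leading_part lt f) a
     = (Poly_Mapping.lookup f a when (\<forall>b \<in> Poly_Mapping.keys f. \<not> lt a b))"
  by (simp add: leading_part_eq_restrict_keys lookup_restrict_keys)

lemma leading_part_0 [simp]: "leading_part lt 0 = 0"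
  by (simp add: leading_part_eq_restrict_keys)

section \<open>Ideals of a commutative ring given by a type class, and leading ideals\<close>

lemma ideal_ring_of_type_algebraI:
  fixes K :: "'a::comm_ring_1 set"
  assumes "0 \<in> K" and "\<And>x y. x \<in> K \<Longrightarrow> y \<in> K \<Longrightarrow> x + y \<in> K"
    and "\<And>r x. x \<in> K \<Longrightarrow> r * x \<in> K"
  shows "ideal K ring_of_type_algebra"
proof -
  interpret R: cring "ring_of_type_algebra :: 'a ring" by rule
  show ?thesis
  proof (rule idealI)
    show "ring (ring_of_type_algebra :: 'a ring)" by (rule ring_from_type_algebra)
    show "subgroup K (add_monoid ring_of_type_algebra)"
    proof (rule R.add.subgroupI)
      fix x :: 'a
      assume "x \<in> K"
      \<comment> \<open>Additive inverses come from closure under multiplication by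
        \<open>- 1\<close>.\<close>
      moreover have "\<ominus>\<^bsub>ring_of_type_algebra\<^esub> x = (- 1) * x"
        by (rule R.minus_equality) (simp_all add: ring_of_type_algebra_def)
      ultimately show "\<ominus>\<^bsub>ring_of_type_algebra\<^esub> x \<in> K"
        using assms(3)[of x "- 1"] by simp
    qed (use assms in \<open>auto simp: ring_of_type_algebra_def\<close>)
  qed (use assms(3) in \<open>auto simp: ring_of_type_algebra_def mult.commute\<close>)
qed

lemma
  fixes K :: "'a::comm_ring_1 set"
  assumes "ideal K ring_of_type_algebra"
  shows ideal_type_algebra_zero: "0 \<in> K"
    and ideal_type_algebra_add: "x \<in> K \<Longrightarrow> y \<in> K \<Longrightarrow> x + y \<in> K"
proof -
  have K: "additive_subgroup K ring_of_type_algebra"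
    by (rule ideal.axioms(1)[OF assms])
  show "0 \<in> K" "x \<in> K \<Longrightarrow> y \<in> K \<Longrightarrow> x + y \<in> K"
    using additive_subgroup.zero_closed[OF K] additive_subgroup.a_closed[OF K, of x y]
    by (simp_all add: ring_of_type_algebra_def)
qed

lemma ideal_type_algebra_sum:
  fixes K :: "'a::comm_ring_1 set"
  assumes "ideal K ring_of_type_algebra" and "\<And>i. i \<in> A \<Longrightarrow> f i \<in> K"
  shows "sum f A \<in> K"
  using assms(2)
  by (induction A rule: infinite_finite_induct)
    (auto simp: ideal_type_algebra_zero[OF assms(1)] ideal_type_algebra_add[OF assms(1)])

lemma ideal_leading_ideal: "ideal (leading_ideal lt G) ring_of_type_algebra"
  unfolding leading_ideal_def
  by (rule ring.genideal_ideal[OF ring_from_type_algebra]) (simp add: ring_of_type_algebra_def)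

lemma leading_part_loc_in_leading_ideal: "f \<in> G \<Longrightarrow> leading_part_loc lt f \<in> leading_ideal lt G"
  using ring.genideal_self[OF ring_from_type_algebra, of "leading_part_loc lt ` G"]
  by (auto simp: leading_ideal_def ring_of_type_algebra_def)

lemma leading_ideal_minimal:
  assumes "ideal K ring_of_type_algebra" and "\<And>f. f \<in> G \<Longrightarrow> leading_part_loc lt f \<in> K"
  shows "leading_ideal lt G \<subseteq> K"
  unfolding leading_ideal_def using assms
  by (intro ring.genideal_minimal[OF ring_from_type_algebra]) auto

section \<open>Monomial preorders and the arithmetic of leading parts\<close>

locale mono_preorder =
  fixes lt :: "'n monom \<Rightarrow> 'n monom \<Rightarrow> bool"
  assumes monomial_preorder: "monomial_preorder lt"
begin

abbreviation inc :: "'n monom \<Rightarrow> 'n monom \<Rightarrow> bool" where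
  "inc \<equiv> incomparable lt"

lemma irrefl: "\<not> lt a a"
  using monomial_preorder by (auto simp: monomial_preorder_def weak_order_def irreflp_def)

lemma trans: "lt a b \<Longrightarrow> lt b c \<Longrightarrow> lt a c"
  using monomial_preorder by (auto simp: monomial_preorder_def weak_order_def dest: transpD)

lemma inc_trans: "inc a b \<Longrightarrow> inc b c \<Longrightarrow> inc a c"
  using monomial_preorder
  by (auto simp: monomial_preorder_def weak_order_def elim: equivp_transp)

lemma inc_refl [simp]: "inc a a"
  using irrefl by (simp add: incomparable_def)

lemma inc_sym: "inc a b \<Longrightarrow> inc b a"
  by (simp add: incomparable_def)

text \<open>If \<open>a\<close> and \<open>c\<close> were incomparable, so would be \<open>a\<close>
  and \<open>b\<close>; if \<open>lt c a\<close>, then \<open>lt c b\<close>. Both contradict the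
  hypotheses.\<close>

lemma lt_inc_trans: "lt a b \<Longrightarrow> inc b c \<Longrightarrow> lt a c"
  by (metis incomparable_def inc_trans trans)

lemma inc_lt_trans: "inc a b \<Longrightarrow> lt b c \<Longrightarrow> lt a c"
  by (metis incomparable_def inc_trans trans)

text \<open>In a weak order, \<open>\<not> lt a b\<close> means that \<open>b\<close> is at most
  \<open>a\<close> in the total preorder induced by the order of the incomparability
  classes.\<close>

lemma not_lt_trans: "\<not> lt a b \<Longrightarrow> \<not> lt b c \<Longrightarrow> \<not> lt a c"
  using inc_lt_trans[of b a c] trans[of b a c] by (auto simp: incomparable_def)

lemma lt_add_right [simp]: "lt (a + c) (b + c) \<longleftrightarrow> lt a b"
  using monomial_preorder by (auto simp: monomial_preorder_def)

lemma lt_add_left [simp]: "lt (c + a) (c + b) \<longleftrightarrow> lt a b"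
  using lt_add_right[of a c b] by (simp add: add.commute)

lemma inc_add_left [simp]: "inc (c + a) (c + b) \<longleftrightarrow> inc a b"
  by (simp add: incomparable_def)

lemma inc_add_right [simp]: "inc (a + c) (b + c) \<longleftrightarrow> inc a b"
  by (simp add: incomparable_def)

text \<open>This is the criterion for recognizing a leading part; \<open>m\<close> merely represents
  an incomparability class. Since \<open>q\<close> is nonzero, it has a monomial, which lies above
  all those of \<open>r\<close>.\<close>

lemma leading_part_add_lower:
  fixes q r :: "('n, 'k::comm_monoid_add) mpoly"
  assumes "q \<noteq> 0" and q: "\<And>a. a \<in> Poly_Mapping.keys q \<Longrightarrow> inc a m"
    and r: "\<And>a. a \<in> Poly_Mapping.keys r \<Longrightarrow> lt a m"
  shows "leading_part lt (q + r) = q"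
proof (rule poly_mapping_eqI)
  fix a
  have r0: "Poly_Mapping.lookup r b = 0" if "b \<in> Poly_Mapping.keys q" for b
    using q[OF that] r[of b] by (auto simp: incomparable_def in_keys_iff)
  have keys: "b \<in> Poly_Mapping.keys q \<or> b \<in> Poly_Mapping.keys r"
    if "b \<in> Poly_Mapping.keys (q + r)" for b
    using that keys_add[of q r] by blast
  show "Poly_Mapping.lookup (leading_part lt (q + r)) a = Poly_Mapping.lookup q a"
  proof (cases "a \<in> Poly_Mapping.keys q")
    case True
    have "\<not> lt a b" if "b \<in> Poly_Mapping.keys (q + r)" for b
      using keys[OF that] q[OF True] q[of b] r[of b]
      by (metis incomparable_def inc_sym inc_trans lt_inc_trans trans)
    then show ?thesis
      using r0[OF True] by (simp add: lookup_leading_part lookup_add)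
  next
    case False
    obtain c where c: "c \<in> Poly_Mapping.keys q"
      using \<open>q \<noteq> 0\<close> by (metis keys_eq_empty ex_in_conv)
    then have "c \<in> Poly_Mapping.keys (q + r)"
      using r0[OF c] by (simp add: in_keys_iff lookup_add)
    moreover have "lt a c" if "a \<in> Poly_Mapping.keys r"
      using r[OF that] q[OF c] by (metis inc_sym lt_inc_trans)
    ultimately have "\<exists>c \<in> Poly_Mapping.keys (q + r). lt a c" if "a \<in> Poly_Mapping.keys r"
      using that by blast
    then show ?thesis
      using False by (auto simp: lookup_leading_part lookup_add in_keys_iff when_def)
  qed
qed

lemma ex_maximal:
  assumes "finite A" and "A \<noteq> {}"
  shows "\<exists>m\<in>A. \<forall>b\<in>A. \<not> lt m b"
  using assms
proof (induction rule: finite_ne_induct)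
  case (singleton x)
  then show ?case by (simp add: irrefl)
next
  case (insert x F)
  then show ?case by (metis insert_iff irrefl trans)
qed

text \<open>Conversely to \<open>leading_part_add_lower\<close>, any maximal monomial of
  \<open>f\<close> serves as \<open>m\<close>: the maximal monomials form one incomparability class,
  and the others lie below it.\<close>

lemma leading_part_cases:
  fixes f :: "('n, 'k::cancel_comm_monoid_add) mpoly"
  assumes "f \<noteq> 0"
  obtains m r where "f = leading_part lt f + r" and "leading_part lt f \<noteq> 0"
    and "\<And>a. a \<in> Poly_Mapping.keys (leading_part lt f) \<Longrightarrow> inc a m"
    and "\<And>a. a \<in> Poly_Mapping.keys r \<Longrightarrow> lt a m"
proof -
  obtain m where m: "m \<in> Poly_Mapping.keys f" "\<And>b. b \<in> Poly_Mapping.keys f \<Longrightarrow> \<not> lt m b"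
    using ex_maximal[of "Poly_Mapping.keys f"] assms by auto
  define r where "r = restrict_keys {a. \<exists>b \<in> Poly_Mapping.keys f. lt a b} f"
  show thesis
  proof
    show "f = leading_part lt f + r"
      by (rule poly_mapping_eqI)
        (auto simp: r_def lookup_add lookup_leading_part lookup_restrict_keys when_def)
    have "m \<in> Poly_Mapping.keys (leading_part lt f)"
      using m by (simp add: keys_leading_part)
    then show "leading_part lt f \<noteq> 0" by auto
    show "inc a m" if "a \<in> Poly_Mapping.keys (leading_part lt f)" for a
      using that m by (auto simp: keys_leading_part incomparable_def)
    show "lt a m" if a: "a \<in> Poly_Mapping.keys r" for a
    proof -
      obtain b where "a \<in> Poly_Mapping.keys f" "b \<in> Poly_Mapping.keys f" "lt a b"
        using a by (auto simp: r_def keys_restrict_keys)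
      then show ?thesis
        using m by (metis incomparable_def inc_lt_trans)
    qed
  qed
qed

lemma one_in_denominators: "(1 :: ('n, 'k::comm_semiring_1) mpoly) \<in> denominators lt"
  by (auto intro!: poly_mapping_eqI
      simp: denominators_def lookup_leading_part irrefl lookup_one when_def)

text \<open>Write \<open>u = 1 + v\<close> with all monomials of \<open>v\<close> below
  \<open>1\<close>. Each monomial of \<open>v * p\<close> is then below one of \<open>p\<close>, so
  it cannot affect the leading part. This makes leading parts well defined on the
  localization.\<close>

lemma leading_part_denominator_mult:
  fixes u p :: "('n, 'k::field) mpoly"
  assumes "u \<in> denominators lt"
  shows "leading_part lt (u * p) = leading_part lt p"
proof (cases "p = 0")
  case False
  have L1: "leading_part lt u = 1"
    using assms by (simp add: denominators_def)
  then have "u \<noteq> 0" by auto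
  then obtain m v where u: "u = 1 + v"
    and "\<And>a. a \<in> Poly_Mapping.keys (1 :: ('n, 'k) mpoly) \<Longrightarrow> inc a m"
    and v: "\<And>a. a \<in> Poly_Mapping.keys v \<Longrightarrow> lt a m"
    using leading_part_cases[of u] L1 by metis
  then have "inc m 0" by (auto intro: inc_sym)
  then have v: "lt a 0" if "a \<in> Poly_Mapping.keys v" for a
    using v[OF that] lt_inc_trans by blast
  obtain m r where p: "p = leading_part lt p + r" and "leading_part lt p \<noteq> 0"
    and L: "\<And>a. a \<in> Poly_Mapping.keys (leading_part lt p) \<Longrightarrow> inc a m"
    and r: "\<And>a. a \<in> Poly_Mapping.keys r \<Longrightarrow> lt a m"
    using leading_part_cases[OF False] by metis
  have "u * p = leading_part lt p + (r + v * p)"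
    using u p by (simp add: algebra_simps)
  moreover have "leading_part lt (leading_part lt p + (r + v * p)) = leading_part lt p"
  proof (rule leading_part_add_lower)
    fix c
    assume "c \<in> Poly_Mapping.keys (r + v * p)"
    then consider "c \<in> Poly_Mapping.keys r" | "c \<in> Poly_Mapping.keys (v * p)"
      using keys_add[of r "v * p"] by blast
    then show "lt c m"
    proof cases
      case 2
      then obtain a b where c: "c = a + b" and a: "a \<in> Poly_Mapping.keys v"
        and b: "b \<in> Poly_Mapping.keys p"
        using keys_mult[of v p] by blast
      have "lt c b"
        using v[OF a] lt_add_right[of a b 0] c by simp
      moreover have "inc b m \<or> lt b m"
        using b L r p keys_add[of "leading_part lt p" r] by auto
      ultimately show ?thesis
        using lt_inc_trans trans by blast
    qed (rule r)
  qed (use L \<open>leading_part lt p \<noteq> 0\<close> in auto)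
  ultimately show ?thesis by simp
qed simp

text \<open>When both leading parts lie in one class, the remaining terms lie below it, so only
  complete cancellation could change the answer; \<open>nonzero\<close> excludes this.\<close>

lemma leading_part_add:
  fixes f g :: "('n, 'k::field) mpoly"
  assumes f: "\<And>a. a \<in> Poly_Mapping.keys (leading_part lt f) \<Longrightarrow> inc a m"
    and g: "\<And>a. a \<in> Poly_Mapping.keys (leading_part lt g) \<Longrightarrow> inc a m"
    and nonzero: "leading_part lt f + leading_part lt g \<noteq> 0"
  shows "leading_part lt (f + g) = leading_part lt f + leading_part lt g"
proof -
  \<comment> \<open>The class found by \<open>leading_part_cases\<close> is moved to the common
    representative \<open>m\<close>; for \<open>h = 0\<close> the remainder is
    \<open>0\<close>.\<close>
  have split: "\<exists>r. h = leading_part lt h + r \<and> (\<forall>a\<in>Poly_Mapping.keys r. lt a m)"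
    if h: "\<And>a. a \<in> Poly_Mapping.keys (leading_part lt h) \<Longrightarrow> inc a m"
    for h :: "('n, 'k) mpoly"
  proof (cases "h = 0")
    case False
    then obtain m' r where r: "h = leading_part lt h + r" "leading_part lt h \<noteq> 0"
      "\<And>a. a \<in> Poly_Mapping.keys (leading_part lt h) \<Longrightarrow> inc a m'"
      "\<And>a. a \<in> Poly_Mapping.keys r \<Longrightarrow> lt a m'"
      using leading_part_cases by metis
    then obtain c where "c \<in> Poly_Mapping.keys (leading_part lt h)"
      by (metis keys_eq_empty ex_in_conv)
    then have "inc m' m"
      using r(3) h by (metis inc_sym inc_trans)
    then show ?thesis
      using r lt_inc_trans by blast
  qed simp
  obtain r where r: "f = leading_part lt f + r" "\<And>a. a \<in> Poly_Mapping.keys r \<Longrightarrow> lt a m"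
    using split[of f] f by blast
  obtain s where s: "g = leading_part lt g + s" "\<And>a. a \<in> Poly_Mapping.keys s \<Longrightarrow> lt a m"
    using split[of g] g by blast
  have "leading_part lt ((leading_part lt f + leading_part lt g) + (r + s))
      = leading_part lt f + leading_part lt g"
  proof (rule leading_part_add_lower[OF nonzero])
    show "inc a m" if "a \<in> Poly_Mapping.keys (leading_part lt f + leading_part lt g)" for a
      using that f g keys_add[of "leading_part lt f" "leading_part lt g"] by blast
    show "lt a m" if "a \<in> Poly_Mapping.keys (r + s)" for a
      using that r(2) s(2) keys_add[of r s] by blast
  qed
  moreover have "(leading_part lt f + leading_part lt g) + (r + s) = f + g"
    using r(1) s(1) by (metis add.assoc add.left_commute)
  ultimately show ?thesis by simp
qed

end

section \<open>Multiplication by a term, and homogeneous components\<close>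

lemma lookup_single_mult:
  fixes f :: "('n, 'k::comm_semiring_1) mpoly"
  shows "Poly_Mapping.lookup (Poly_Mapping.single a c * f) (a + b) = c * Poly_Mapping.lookup f b"
proof (induction f rule: poly_mapping_add_induct)
  case (single a' c')
  then show ?case by (simp add: mult_single lookup_single when_def)
qed (simp_all add: distrib_left lookup_add)

text \<open>No term is lost: the shift by \<open>a\<close> is injective, and a product of nonzero
  coefficients is nonzero.\<close>

lemma keys_single_mult:
  fixes f :: "('n, 'k::field) mpoly"
  assumes "c \<noteq> 0"
  shows "Poly_Mapping.keys (Poly_Mapping.single a c * f) = (+) a ` Poly_Mapping.keys f"
proof
  show "Poly_Mapping.keys (Poly_Mapping.single a c * f) \<subseteq> (+) a ` Poly_Mapping.keys f"
    using keys_mult[of "Poly_Mapping.single a c" f] by (auto split: if_splits)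
  show "(+) a ` Poly_Mapping.keys f \<subseteq> Poly_Mapping.keys (Poly_Mapping.single a c * f)"
    using assms by (auto simp: in_keys_iff lookup_single_mult)
qed

context mono_preorder
begin

text \<open>The shift by \<open>a\<close> preserves and reflects \<open>lt\<close>, so it carries
  maximal monomials exactly to maximal monomials.\<close>

lemma leading_part_single_mult:
  fixes f :: "('n, 'k::field) mpoly"
  shows "leading_part lt (Poly_Mapping.single a c * f) = Poly_Mapping.single a c * leading_part lt f"
proof (cases "c = 0")
  case False
  note keys = keys_single_mult[OF False]
  show ?thesis
  proof (rule poly_mapping_eqI)
    fix x
    show "Poly_Mapping.lookup (leading_part lt (Poly_Mapping.single a c * f)) x
        = Poly_Mapping.lookup (Poly_Mapping.single a c * leading_part lt f) x"
    proof (cases "\<exists>b. x = a + b")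
      case True
      then show ?thesis
        by (auto simp: lookup_leading_part lookup_single_mult keys when_def)
    next
      \<comment> \<open>\<open>lookup_single_mult\<close> only covers multiples of the monomial
        \<open>a\<close>; at any other monomial both coefficients vanish.\<close>
      case no_factor: False
      then have "x \<notin> Poly_Mapping.keys (Poly_Mapping.single a c * h)" for h :: "('n, 'k) mpoly"
        by (auto simp: keys)
      then show ?thesis
        by (simp add: lookup_leading_part in_keys_iff)
    qed
  qed
qed simp

lemma restrict_keys_single_mult:
  fixes f :: "('n, 'k::field) mpoly"
  shows "restrict_keys {x. inc x (a + b)} (Poly_Mapping.single a c * f)
     = Poly_Mapping.single a c * restrict_keys {x. inc x b} f"
proof (cases "c = 0")
  case False
  note keys = keys_single_mult[OF False]
  show ?thesis
  proof (rule poly_mapping_eqI)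
    fix x
    show "Poly_Mapping.lookup (restrict_keys {x. inc x (a + b)} (Poly_Mapping.single a c * f)) x
        = Poly_Mapping.lookup (Poly_Mapping.single a c * restrict_keys {x. inc x b} f) x"
    proof (cases "\<exists>b. x = a + b")
      case True
      then show ?thesis
        by (auto simp: lookup_restrict_keys lookup_single_mult when_def)
    next
      case no_factor: False
      then have "x \<notin> Poly_Mapping.keys (Poly_Mapping.single a c * h)" for h :: "('n, 'k) mpoly"
        by (auto simp: keys)
      then show ?thesis
        by (simp add: lookup_restrict_keys in_keys_iff)
    qed
  qed
qed simp

text \<open>The sum is indexed by the classes themselves, not by representatives, so each monomial
  is counted exactly once.\<close>

lemma sum_homogeneous_components:
  fixes f :: "('n, 'k::comm_monoid_add) mpoly"
  shows "(\<Sum>C\<in>(\<lambda>m. {x. inc x m}) ` Poly_Mapping.keys f. restrict_keys C f) = f"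
proof (rule poly_mapping_eqI)
  fix a
  let ?\<C> = "(\<lambda>m. {x. inc x m}) ` Poly_Mapping.keys f"
  have "a \<in> C \<longleftrightarrow> C = {x. inc x a}" if "C \<in> ?\<C>" for C
    using that by (auto intro: inc_trans inc_sym)
  then have "Poly_Mapping.lookup (\<Sum>C\<in>?\<C>. restrict_keys C f) a
      = (\<Sum>C\<in>?\<C>. if {x. inc x a} = C then Poly_Mapping.lookup f a else 0)"
    unfolding lookup_sum by (intro sum.cong) (auto simp: lookup_restrict_keys when_def)
  also have "\<dots> = Poly_Mapping.lookup f a"
    by (subst sum.delta') (auto simp: in_keys_iff)
  finally show "Poly_Mapping.lookup (\<Sum>C\<in>?\<C>. restrict_keys C f) a = Poly_Mapping.lookup f a" .
qed

end

section \<open>Leading parts in the localization\<close>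

locale linorder_mono_preorder = mono_preorder lt
  for lt :: "'n::linorder monom \<Rightarrow> 'n monom \<Rightarrow> bool"
begin

lemma denominator_nonzero: "(u :: ('n, 'k::field) mpoly) \<in> denominators lt \<Longrightarrow> u \<noteq> 0"
  by (auto simp: denominators_def)

text \<open>Two choices of numerator satisfy \<open>u * q = v * p\<close> already in the polynomial
  ring, and multiplying by a denominator does not change leading parts.\<close>

lemma leading_part_loc_eq:
  fixes p u :: "('n, 'k::field) mpoly"
  assumes u: "u \<in> denominators lt" and p: "to_fract u * f = to_fract p"
  shows "leading_part_loc lt f = leading_part lt p"
proof -
  define q where "q = (SOME p. \<exists>u \<in> denominators lt. to_fract u * f = to_fract p)"
  have "\<exists>u \<in> denominators lt. to_fract u * f = to_fract q"
    unfolding q_def by (rule someI) (use assms in blast)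
  then obtain v where v: "v \<in> denominators lt" "to_fract v * f = to_fract q" by blast
  have "to_fract (u * q) = to_fract (v * p)"
    unfolding to_fract_mult p[symmetric] v(2)[symmetric] by (rule mult.left_commute)
  then have "leading_part lt (u * q) = leading_part lt (v * p)"
    by (simp only: to_fract_eq_iff)
  then have "leading_part lt q = leading_part lt p"
    by (simp add: leading_part_denominator_mult u v(1))
  then show ?thesis
    by (simp add: leading_part_loc_def q_def)
qed

lemma leading_part_loc_to_fract:
  fixes p :: "('n, 'k::field) mpoly"
  shows "leading_part_loc lt (to_fract p) = leading_part lt p"
  by (rule leading_part_loc_eq[OF one_in_denominators]) simp

lemma localization_numerator:
  fixes f :: "('n, 'k::field) mpoly fract"
  assumes "f \<in> localization lt"
  obtains u p where "u \<in> denominators lt" and "to_fract u * f = to_fract p"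
  using assms denominator_nonzero by (force simp: localization_def)

lemma to_fract_in_localization: "to_fract (p :: ('n, 'k::field) mpoly) \<in> localization lt"
  unfolding localization_def using one_in_denominators by force

end

section \<open>Products of preorders, and global preorders\<close>

lemma monomial_preorder_product:
  assumes "monomial_preorder lt" and "monomial_preorder lt'"
  shows "monomial_preorder (product_preorder lt lt')"
proof -
  interpret L: mono_preorder lt by unfold_locales fact
  interpret L': mono_preorder lt' by unfold_locales fact
  \<comment> \<open>Incomparability for the product is the intersection of two equivalence
    relations, hence again one.\<close>
  have inc: "incomparable (product_preorder lt lt') a b \<longleftrightarrow> L.inc a b \<and> L'.inc a b" for a b
    by (auto simp: incomparable_def product_preorder_def)
  have "transp (product_preorder lt lt')"
    unfolding product_preorder_def
    by (rule transpI) (blast intro: L.trans L'.trans L.inc_trans L.lt_inc_trans L.inc_lt_trans)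
  moreover have "irreflp (product_preorder lt lt')"
    by (simp add: irreflp_def product_preorder_def L.irrefl L'.irrefl)
  moreover have "equivp (incomparable (product_preorder lt lt'))"
    by (rule equivpI) (auto simp: inc reflp_def symp_def transp_def
        intro: L.inc_sym L'.inc_sym L.inc_trans L'.inc_trans)
  ultimately show ?thesis
    by (simp add: monomial_preorder_def weak_order_def product_preorder_def)
qed

text \<open>The monomials not below \<open>1\<close> are closed under products and contain every
  variable, hence are all monomials.\<close>

lemma global_preorder_not_less_one:
  fixes lt :: "'n monom \<Rightarrow> 'n monom \<Rightarrow> bool"
  assumes "monomial_preorder lt" and "global_preorder lt"
  shows "\<not> lt a 0"
proof -
  interpret mono_preorder lt by unfold_locales fact
  have add: "\<not> lt (a + b) 0" if "\<not> lt a 0" "\<not> lt b 0" for a b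
    using that lt_add_right[of a b 0, unfolded add_0] not_lt_trans[of "a + b" b 0] by blast
  show ?thesis
  proof (induction a rule: poly_mapping_add_induct)
    case zero
    show ?case by (rule irrefl)
  next
    case (single i c)
    show ?case
    \<comment> \<open>Here \<open>single i c\<close> is the exponent vector of the
      \<open>c\<close>-th power of a variable.\<close>
    proof (induction c)
      case 0
      show ?case by (simp add: irrefl)
    next
      case (Suc c)
      have "\<not> lt (Poly_Mapping.single i 1) 0"
        using assms(2) irrefl trans by (metis global_preorder_def incomparable_def)
      from add[OF this Suc] show ?case
        by (simp flip: single_add)
    qed
  qed (rule add)
qed

text \<open>Maximality for the product means maximality for \<open>lt\<close>, and then for
  \<open>lt'\<close> among the \<open>lt\<close>-maximal monomials.\<close>

lemma leading_part_product:
  fixes f :: "('n, 'k::comm_monoid_add) mpoly"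
  assumes "monomial_preorder lt"
  shows "leading_part (product_preorder lt lt') f = leading_part lt' (leading_part lt f)"
proof -
  interpret mono_preorder lt by unfold_locales fact
  have "(\<forall>b\<in>Poly_Mapping.keys f. \<not> product_preorder lt lt' a b) \<longleftrightarrow>
      (\<forall>b\<in>Poly_Mapping.keys f. \<not> lt a b) \<and>
      (\<forall>b\<in>Poly_Mapping.keys (leading_part lt f). \<not> lt' a b)"
    if "a \<in> Poly_Mapping.keys f" for a
    \<comment> \<open>From right to left: a monomial of \<open>f\<close> incomparable to an
      \<open>lt\<close>-maximal one is itself \<open>lt\<close>-maximal, so it occurs in
      \<open>leading_part lt f\<close>.\<close>
    using that
    by (auto simp: product_preorder_def keys_leading_part incomparable_def)
       (metis incomparable_def inc_lt_trans)
  then show ?thesis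
    by (intro poly_mapping_eqI) (auto simp: lookup_leading_part when_def in_keys_iff)
qed

section \<open>The inclusion for arbitrary subsets, and the localization for a global second
  preorder\<close>

locale two_preorders =
  L: linorder_mono_preorder lt + L': linorder_mono_preorder lt'
  for lt lt' :: "'n::linorder monom \<Rightarrow> 'n monom \<Rightarrow> bool"
begin

abbreviation ltp :: "'n monom \<Rightarrow> 'n monom \<Rightarrow> bool" where
  "ltp \<equiv> product_preorder lt lt'"

sublocale P: linorder_mono_preorder ltp
  by unfold_locales (intro monomial_preorder_product L.monomial_preorder L'.monomial_preorder)

lemmas leading_part_ltp = leading_part_product[OF L.monomial_preorder]

text \<open>If \<open>leading_part lt u = 1\<close>, taking the \<open>lt'\<close>-leading part of
  \<open>1\<close> gives \<open>1\<close> again.\<close>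

lemma denominators_subset: "(denominators lt :: ('n, 'k::field) mpoly set) \<subseteq> denominators ltp"
  using L'.one_in_denominators[where 'k = 'k] by (auto simp: denominators_def leading_part_ltp)

text \<open>A denominator of \<open>f\<close> for \<open>lt\<close> is also one for
  \<open>ltp\<close>, so a single numerator computes both sides.\<close>

lemma leading_part_loc_product:
  fixes f :: "('n, 'k::field) mpoly fract"
  assumes "f \<in> localization lt"
  shows "leading_part_loc ltp f = leading_part lt' (leading_part_loc lt f)"
proof -
  obtain u p where u: "u \<in> denominators lt" and p: "to_fract u * f = to_fract p"
    using assms by (rule L.localization_numerator)
  have "u \<in> denominators ltp"
    using u denominators_subset by blast
  then show ?thesis
    using L.leading_part_loc_eq[OF u p] P.leading_part_loc_eq[OF _ p]
    by (simp add: leading_part_ltp)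
qed

text \<open>It suffices to treat generators. As \<open>leading_ideal\<close> takes sets of
  fractions, the polynomial ideal \<open>leading_ideal lt G\<close> is embedded by
  \<open>to_fract\<close>.\<close>

lemma leading_ideal_product_subset:
  fixes G :: "('n, 'k::field) mpoly fract set"
  assumes "G \<subseteq> localization lt"
  shows "leading_ideal ltp G \<subseteq> leading_ideal lt' (to_fract ` leading_ideal lt G)"
proof (rule leading_ideal_minimal[OF ideal_leading_ideal])
  fix f
  assume f: "f \<in> G"
  then have "leading_part_loc ltp f = leading_part_loc lt' (to_fract (leading_part_loc lt f))"
    using assms leading_part_loc_product by (auto simp: L'.leading_part_loc_to_fract)
  then show "leading_part_loc ltp f \<in> leading_ideal lt' (to_fract ` leading_ideal lt G)"
    using f by (simp add: leading_part_loc_in_leading_ideal)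
qed

lemma localization_product_global:
  assumes "global_preorder lt'"
  shows "(localization ltp :: ('n, 'k::field) mpoly fract set) = localization lt"
proof -
  have "leading_part lt u = 1" if "leading_part lt' (leading_part lt u) = 1"
    for u :: "('n, 'k) mpoly"
  proof -
    let ?g = "leading_part lt u"
    have "0 \<in> Poly_Mapping.keys (leading_part lt' ?g)"
      unfolding that by simp
    then have "\<not> lt' 0 b" if "b \<in> Poly_Mapping.keys ?g" for b
      using that by (simp add: keys_leading_part)
    \<comment> \<open>No monomial is below \<open>1\<close>, and \<open>1\<close> is below no
      monomial of \<open>?g\<close>; hence nothing is below a monomial of \<open>?g\<close>, and all
      its terms are leading.\<close>
    then have "\<not> lt' a b" if "b \<in> Poly_Mapping.keys ?g" for a b
      using L'.not_lt_trans[OF global_preorder_not_less_one[OF L'.monomial_preorder assms]] that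
      by blast
    then have "leading_part lt' ?g = ?g"
      by (intro poly_mapping_eqI) (auto simp: lookup_leading_part when_def)
    with that show ?thesis by simp
  qed
  then have "(denominators ltp :: ('n, 'k) mpoly set) = denominators lt"
    using denominators_subset[where 'k = 'k] by (auto simp: denominators_def leading_part_ltp)
  then show ?thesis
    by (simp add: localization_def)
qed

end

section \<open>Homogeneous components of the leading ideal of an ideal\<close>

context linorder_mono_preorder
begin

text \<open>Closure under polynomial multiples allows denominators to be cleared without leaving
  \<open>I\<close>.\<close>

lemma
  fixes I :: "('n, 'k::field) mpoly fract set"
  assumes "ideal I (localization_ring lt)"
  shows ideal_localization_subset: "I \<subseteq> localization lt"
    and ideal_localization_zero: "0 \<in> I"
    and ideal_localization_add: "f \<in> I \<Longrightarrow> g \<in> I \<Longrightarrow> f + g \<in> I"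
    and ideal_localization_mult: "f \<in> I \<Longrightarrow> to_fract p * f \<in> I"
proof -
  have sub: "additive_subgroup I (localization_ring lt)"
    by (rule ideal.axioms(1)[OF assms])
  show "I \<subseteq> localization lt" "0 \<in> I" "f \<in> I \<Longrightarrow> g \<in> I \<Longrightarrow> f + g \<in> I"
    "f \<in> I \<Longrightarrow> to_fract p * f \<in> I"
    using additive_subgroup.a_subset[OF sub] additive_subgroup.zero_closed[OF sub]
      additive_subgroup.a_closed[OF sub, of f g] ideal.I_l_closed[OF assms, of f "to_fract p"]
      to_fract_in_localization[of p]
    by (auto simp: localization_ring_def ring_of_type_algebra_def)
qed

text \<open>The polynomials all of whose components are leading parts of polynomials in
  \<open>I\<close> form an ideal \<open>M\<close> that contains the generators.\<close>

lemma homogeneous_component_leading_ideal: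
  fixes I :: "('n, 'k::field) mpoly fract set"
  assumes I: "ideal I (localization_ring lt)" and g: "g \<in> leading_ideal lt I"
  obtains p where "to_fract p \<in> I" and "restrict_keys {x. inc x m} g = leading_part lt p"
proof -
  define H where "H = {leading_part lt p | p. to_fract p \<in> I}"
  define M where "M = {g :: ('n, 'k) mpoly. \<forall>m. restrict_keys {x. inc x m} g \<in> H}"
  have H0: "0 \<in> H"
    using ideal_localization_zero[OF I] unfolding H_def by (auto intro!: exI[of _ 0])
  have M_add: "f + g \<in> M" if "f \<in> M" "g \<in> M" for f g
  proof -
    have "restrict_keys {x. inc x m} (f + g) \<in> H" for m
    proof -
      obtain p q where p: "to_fract p \<in> I" "restrict_keys {x. inc x m} f = leading_part lt p"
        and q: "to_fract q \<in> I" "restrict_keys {x. inc x m} g = leading_part lt q"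
        using \<open>f \<in> M\<close> \<open>g \<in> M\<close> by (auto simp: M_def H_def) metis
      show ?thesis
      \<comment> \<open>If the leading parts cancel, the component is \<open>0\<close>, the leading
        part of \<open>0\<close>; otherwise \<open>p + q\<close> is the witness.\<close>
      proof (cases "leading_part lt p + leading_part lt q = 0")
        case True
        then show ?thesis
          using p q H0 by (simp add: restrict_keys_add)
      next
        case False
        have "leading_part lt (p + q) = leading_part lt p + leading_part lt q"
          by (rule leading_part_add[OF _ _ False, of m])
            (auto simp: keys_restrict_keys simp flip: p(2) q(2))
        moreover have "to_fract (p + q) \<in> I"
          using ideal_localization_add[OF I p(1) q(1)] by simp
        ultimately show ?thesis
          using p(2) q(2) unfolding H_def by (auto simp: restrict_keys_add intro!: exI[of _ "p + q"])
      qed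
    qed
    then show ?thesis by (simp add: M_def)
  qed
  have M_single: "Poly_Mapping.single a c * g \<in> M" if "g \<in> M" for a c g
  proof -
    have "restrict_keys {x. inc x m} (Poly_Mapping.single a c * g) \<in> H" for m
    \<comment> \<open>A class containing a multiple of the monomial \<open>a\<close> receives a
      shifted component of \<open>g\<close>; any other class receives nothing.\<close>
    proof (cases "\<exists>b. inc (a + b) m")
      case True
      then obtain b where b: "inc (a + b) m" by blast
      then have "{x. inc x m} = {x. inc x (a + b)}"
        by (auto intro: inc_trans inc_sym)
      then have "restrict_keys {x. inc x m} (Poly_Mapping.single a c * g)
          = Poly_Mapping.single a c * restrict_keys {x. inc x b} g"
        by (simp add: restrict_keys_single_mult)
      moreover obtain p where p: "to_fract p \<in> I" "restrict_keys {x. inc x b} g = leading_part lt p"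
        using \<open>g \<in> M\<close> by (auto simp: M_def H_def)
      moreover have "to_fract (Poly_Mapping.single a c * p) \<in> I"
        using ideal_localization_mult[OF I p(1)] by simp
      ultimately show ?thesis
        unfolding H_def by (auto simp flip: leading_part_single_mult)
    next
      case False
      have "restrict_keys {x. inc x m} (Poly_Mapping.single a c * g) = 0"
        using False keys_mult[of "Poly_Mapping.single a c" g]
        by (intro restrict_keys_eq_0) (auto split: if_splits)
      then show ?thesis using H0 by simp
    qed
    then show ?thesis by (simp add: M_def)
  qed
  have "ideal M ring_of_type_algebra"
  proof (rule ideal_ring_of_type_algebraI)
    show "0 \<in> M"
      using H0 by (simp add: M_def)
    show "r * x \<in> M" if "x \<in> M" for r x
    proof (induction r rule: poly_mapping_add_induct)
      case zero
      show ?case using \<open>0 \<in> M\<close> by simp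
    next
      case (single a c)
      show ?case by (rule M_single) fact
    next
      case (add f g)
      then show ?case by (simp add: distrib_right M_add)
    qed
  qed (rule M_add)
  moreover have "leading_part_loc lt f \<in> M" if f: "f \<in> I" for f
  proof -
    obtain u p where u: "u \<in> denominators lt" and p: "to_fract u * f = to_fract p"
      using f ideal_localization_subset[OF I] localization_numerator by blast
    have "to_fract p \<in> I"
      using ideal_localization_mult[OF I f, of u] p by simp
    have "restrict_keys {x. inc x m} (leading_part lt p) \<in> H" for m
    \<comment> \<open>A leading part is homogeneous: its component at \<open>m\<close> is either all
      of it or \<open>0\<close>.\<close>
    proof (cases "\<exists>b \<in> Poly_Mapping.keys (leading_part lt p). inc b m")
      case True
      then have "Poly_Mapping.keys (leading_part lt p) \<subseteq> {x. inc x m}"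
        by (auto simp: keys_leading_part) (metis incomparable_def inc_trans)
      then show ?thesis
        using \<open>to_fract p \<in> I\<close> by (auto simp: restrict_keys_eq_self H_def)
    next
      case False
      then have "restrict_keys {x. inc x m} (leading_part lt p) = 0"
        by (intro restrict_keys_eq_0) auto
      then show ?thesis using H0 by simp
    qed
    then show ?thesis
      by (simp add: M_def leading_part_loc_eq[OF u p])
  qed
  ultimately have "g \<in> M"
    using leading_ideal_minimal g by blast
  then show thesis
    using that by (auto simp: M_def H_def)
qed

end

section \<open>Equality of the leading ideals for an ideal\<close>

context two_preorders
begin

text \<open>The class of \<open>m\<close> contains a monomial that is \<open>lt'\<close>-maximal in
  all of \<open>g\<close>. So being \<open>lt'\<close>-maximal within the class already implies
  being maximal in \<open>g\<close>.\<close>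

lemma restrict_keys_leading_part:
  fixes g :: "('n, 'k::comm_monoid_add) mpoly"
  assumes m: "m \<in> Poly_Mapping.keys (leading_part lt' g)"
  shows "restrict_keys {x. L.inc x m} (leading_part lt' g)
       = leading_part lt' (restrict_keys {x. L.inc x m} g)"
proof -
  have mg: "m \<in> Poly_Mapping.keys g" "\<And>b. b \<in> Poly_Mapping.keys g \<Longrightarrow> \<not> lt' m b"
    using m by (auto simp: keys_leading_part)
  then have "\<not> lt' a m \<Longrightarrow> b \<in> Poly_Mapping.keys g \<Longrightarrow> \<not> lt' a b" for a b
    using L'.not_lt_trans by blast
  then show ?thesis
    using mg(1) by (intro poly_mapping_eqI)
      (auto simp: lookup_leading_part lookup_restrict_keys keys_restrict_keys when_def)
qed

lemma leading_ideal_product_supset: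
  fixes I :: "('n, 'k::field) mpoly fract set"
  assumes I: "ideal I (localization_ring lt)"
  shows "leading_ideal lt' (to_fract ` leading_ideal lt I) \<subseteq> leading_ideal ltp I"
proof (rule leading_ideal_minimal[OF ideal_leading_ideal])
  let ?K = "leading_ideal ltp I"
  fix f
  assume "f \<in> to_fract ` leading_ideal lt I"
  then obtain g where g: "g \<in> leading_ideal lt I" and f: "f = to_fract g" by blast
  let ?h = "leading_part lt' g"
  \<comment> \<open>Only classes meeting the support of \<open>?h\<close> are used, as
    \<open>restrict_keys_leading_part\<close> requires.\<close>
  have component: "restrict_keys C ?h \<in> ?K"
    if C: "C \<in> (\<lambda>m. {x. L.inc x m}) ` Poly_Mapping.keys ?h" for C
  proof -
    obtain m where m: "m \<in> Poly_Mapping.keys ?h" "C = {x. L.inc x m}"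
      using C by blast
    obtain p where p: "to_fract p \<in> I" "restrict_keys {x. L.inc x m} g = leading_part lt p"
      using L.homogeneous_component_leading_ideal[OF I g] by blast
    \<comment> \<open>The component of \<open>?h\<close> is the \<open>lt'\<close>-leading part of
      the component of \<open>g\<close>, which is \<open>leading_part lt p\<close>; the two leading
      parts compose to that for \<open>ltp\<close>.\<close>
    have "restrict_keys C ?h = leading_part_loc ltp (to_fract p)"
      using m p(2) by (simp add: restrict_keys_leading_part leading_part_ltp P.leading_part_loc_to_fract)
    then show ?thesis
      using p(1) by (simp add: leading_part_loc_in_leading_ideal)
  qed
  have "(\<Sum>C\<in>(\<lambda>m. {x. L.inc x m}) ` Poly_Mapping.keys ?h. restrict_keys C ?h) \<in> ?K"
    by (intro ideal_type_algebra_sum ideal_leading_ideal component)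
  then show "leading_part_loc lt' f \<in> ?K"
    by (simp add: f L'.leading_part_loc_to_fract L.sum_homogeneous_components)
qed

end

theorem lemma2p2:
  fixes lt lt' :: "('n::{finite,linorder}) monom \<Rightarrow> 'n monom \<Rightarrow> bool"
  assumes "monomial_preorder lt" and "monomial_preorder lt'"
  shows "(\<forall>G :: ('n, 'k::field) mpoly fract set. G \<subseteq> localization lt \<longrightarrow>
            leading_ideal (product_preorder lt lt') G
              \<subseteq> leading_ideal lt' (to_fract ` leading_ideal lt G)) \<and>
         (\<forall>I :: ('n, 'k) mpoly fract set. ideal I (localization_ring lt) \<longrightarrow>
            leading_ideal (product_preorder lt lt') I
              = leading_ideal lt' (to_fract ` leading_ideal lt I)) \<and>
         (global_preorder lt' \<longrightarrow>
            (localization (product_preorder lt lt') :: ('n, 'k) mpoly fract set) = localization lt)"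
proof -
  interpret two_preorders lt lt'
    by unfold_locales (use assms in auto)
  show ?thesis
    \<comment> \<open>For an ideal, one inclusion is the subset case, since \<open>I\<close> lies in
      the localization.\<close>
    using leading_ideal_product_subset leading_ideal_product_supset
      L.ideal_localization_subset localization_product_global
    by (metis subset_antisym)
qed

end
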